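(* Suppose $G$ is a graph whose automorphism group $\operatorname{Aut}(G)$ is infinite and subdegree-finite. If $G$ has a finite base $B$, then $G$ has a finite distinguishing set with at most $\left\lceil\frac{5n}{2}\right\rceil - b(n) - 1$ elements, where $n=|B|$ and $b(n)$ denotes the number of 1s in the base-2 representation of $n$.
   Context: A base of $G$ is a set $S$ of vertices whose pointwise stabilizer in $\operatorname{Aut}(G)$ (automorphisms fixing every vertex of $S$) is trivial. A set $S$ of vertices is distinguishing if the only automorphism $\varphi$ of $G$ with $\varphi(S)=S$ (setwise) is the identity. A permutation group is subdegree-finite if all orbits of each of its point (vertex) stabilizers are finite. *)

theory Defs
  imports
    "Graph_Theory.Pair_Digraph"
    "HOL-Algebra.Bij"
    "HOL-Algebra.Group_Action"
begin

text \<open>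
  A simple undirected graph, finite or infinite, is a \<^locale>\<open>pair_bidirected_digraph\<close>:
  the arcs form a symmetric irreflexive relation on the vertex set. (The locale
  \<^locale>\<open>pair_graph\<close> would additionally force finiteness.)
\<close>

definition Aut :: "'a pair_pre_digraph \<Rightarrow> ('a \<Rightarrow> 'a) monoid" where
  "Aut G = BijGroup (pverts G)
     \<lparr>carrier := {f \<in> Bij (pverts G).
        \<forall>u\<in>pverts G. \<forall>v\<in>pverts G. (u, v) \<in> parcs G \<longleftrightarrow> (f u, f v) \<in> parcs G}\<rparr>"

lemma carrier_Aut:
  "carrier (Aut G) = {f \<in> Bij (pverts G).
     \<forall>u\<in>pverts G. \<forall>v\<in>pverts G. (u, v) \<in> parcs G \<longleftrightarrow> (f u, f v) \<in> parcs G}"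
  by (simp add: Aut_def)

lemma one_Aut: "\<one>\<^bsub>Aut G\<^esub> = (\<lambda>v\<in>pverts G. v)"
  by (simp add: Aut_def BijGroup_def)

lemma subgroup_Aut: "subgroup (carrier (Aut G)) (BijGroup (pverts G))"
proof -
  let ?V = "pverts G"
  interpret B: group "BijGroup ?V" by (rule group_BijGroup)
  show ?thesis
  proof (rule B.subgroupI)
    show "carrier (Aut G) \<subseteq> carrier (BijGroup ?V)"
      by (auto simp: carrier_Aut BijGroup_def)
    have "(\<lambda>v\<in>?V. v) \<in> carrier (Aut G)"
      by (simp add: carrier_Aut id_Bij)
    then show "carrier (Aut G) \<noteq> {}" by blast
  next
    fix f assume f: "f \<in> carrier (Aut G)"
    let ?g = "restrict (inv_into ?V f) ?V"
    have fB: "f \<in> Bij ?V" using f by (simp add: carrier_Aut)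
    have inv: "inv\<^bsub>BijGroup ?V\<^esub> f = ?g"
      using fB by (rule inv_BijGroup)
    have gV: "inv_into ?V f u \<in> ?V" and fg: "f (inv_into ?V f u) = u" if "u \<in> ?V" for u
      using fB that by (auto simp: Bij_def bij_betw_def inv_into_into f_inv_into_f)
    have "(u, v) \<in> parcs G \<longleftrightarrow> (?g u, ?g v) \<in> parcs G" if "u \<in> ?V" "v \<in> ?V" for u v
      using f gV[OF that(1)] gV[OF that(2)] fg[OF that(1)] fg[OF that(2)] that
      by (auto simp: carrier_Aut)
    then show "inv\<^bsub>BijGroup ?V\<^esub> f \<in> carrier (Aut G)"
      using restrict_inv_into_Bij[OF fB] unfolding inv carrier_Aut by blast
  next
    fix f g assume f: "f \<in> carrier (Aut G)" and g: "g \<in> carrier (Aut G)"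
    have B: "f \<in> Bij ?V" "g \<in> Bij ?V" using f g by (auto simp: carrier_Aut)
    have "g v \<in> ?V" if "v \<in> ?V" for v using Bij_imp_funcset[OF B(2)] that by auto
    then show "f \<otimes>\<^bsub>BijGroup ?V\<^esub> g \<in> carrier (Aut G)"
      using f g compose_Bij[OF B] B by (auto simp: carrier_Aut BijGroup_def compose_def)
  qed
qed

lemma group_Aut: "group (Aut G)"
  using group.subgroup_imp_group[OF group_BijGroup subgroup_Aut]
  by (simp add: Aut_def)

definition pointwise_stabilizer :: "('a \<Rightarrow> 'a) monoid \<Rightarrow> 'a set \<Rightarrow> ('a \<Rightarrow> 'a) set" where
  "pointwise_stabilizer P S = {f \<in> carrier P. \<forall>x\<in>S. f x = x}"

definition is_base :: "'a pair_pre_digraph \<Rightarrow> 'a set \<Rightarrow> bool" where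
  "is_base G S \<longleftrightarrow> S \<subseteq> pverts G \<and> pointwise_stabilizer (Aut G) S = {\<one>\<^bsub>Aut G\<^esub>}"

definition distinguishing :: "'a pair_pre_digraph \<Rightarrow> 'a set \<Rightarrow> bool" where
  "distinguishing G S \<longleftrightarrow>
     S \<subseteq> pverts G \<and> (\<forall>f\<in>carrier (Aut G). f ` S = S \<longrightarrow> f = \<one>\<^bsub>Aut G\<^esub>)"

text \<open>Here \<open>P\<close> is a group of permutations of \<open>E\<close>, acting naturally, i.e.\ by \<open>\<lambda>f. f\<close>.\<close>

definition subdegree_finite :: "('a \<Rightarrow> 'a) monoid \<Rightarrow> 'a set \<Rightarrow> bool" where
  "subdegree_finite P E \<longleftrightarrow>
     (\<forall>x\<in>E. \<forall>C\<in>orbits (P\<lparr>carrier := stabilizer P (\<lambda>f. f) x\<rparr>) E (\<lambda>f. f). finite C)"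

definition binary_ones :: "nat \<Rightarrow> nat" where
  "binary_ones n = card {k. bit n k}"

end

theory Submission
  imports Defs "HOL-Combinatorics.Permutations"
begin

text \<open>
  Subdegree-finiteness and the finite base \<open>B\<close> make all point stabilizers finite, so for finite
  sets \<open>X\<close> and \<open>Y\<close> only finitely many automorphisms move \<open>X\<close> to a set that meets \<open>Y\<close>. Hence points
  \<open>g b\<close> far away from \<open>B\<close> and from each other can be added to \<open>B\<close> such that every automorphism
  preserving the enlarged set preserves \<open>B\<close> and fixes every new point. Let \<open>H\<close> be the setwise
  stabilizer of \<open>B\<close>. Which elements of \<open>H\<close> fix which of the points \<open>g b\<close>, for \<open>b \<in> B\<close>, is a
  finite datum, so infinitely many \<open>g\<close> share it. Among these \<open>g\<close>, new points \<open>g b\<close> for all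
  \<open>b\<close> in a suitable \<open>D \<subseteq> B\<close> leave only the identity of \<open>H\<close>; choosing \<open>D\<close> greedily gives
  \<open>2 ^ |D| \<le> |H| \<le> n!\<close>, so \<open>|D| \<le> n\<close>, and \<open>|D| \<le> n - 1\<close> if \<open>n \<le> 3\<close>.
\<close>

section \<open>Descending chains of subgroups of a finite group\<close>

lemma (in group) card_psubgroup_le:
  assumes H: "subgroup H G" "finite H" and K: "subgroup K G" "K \<subset> H"
  shows "2 * card K \<le> card H"
proof -
  obtain h where h: "h \<in> H" "h \<notin> K" using K by blast
  have hG: "h \<in> carrier G" using subgroup.mem_carrier[OF H(1) h(1)] .
  have KG: "K \<subseteq> carrier G" using subgroup.subset[OF K(1)] .
  have fK: "finite K" using H K finite_subset by blast
  \<comment> \<open>The coset \<open>hK\<close> lies in \<open>H\<close>, has as many elements as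
    \<open>K\<close> and is disjoint from \<open>K\<close>.\<close>
  have inj: "inj_on ((\<otimes>) h) K"
    using hG KG by (auto intro!: inj_onI simp: subset_iff)
  have disj: "(\<otimes>) h ` K \<inter> K = {}"
  proof -
    have False if "k \<in> K" "h \<otimes> k \<in> K" for k
    proof -
      have "(h \<otimes> k) \<otimes> inv k \<in> K"
        using that K by (simp add: subgroup.m_closed subgroup.m_inv_closed)
      moreover have "(h \<otimes> k) \<otimes> inv k = h"
        using that hG KG by (simp add: m_assoc subset_iff)
      ultimately show False using h by simp
    qed
    then show ?thesis by blast
  qed
  have "(\<otimes>) h ` K \<union> K \<subseteq> H"
    using h K H by (auto intro: subgroup.m_closed)
  then have "card ((\<otimes>) h ` K \<union> K) \<le> card H" using H card_mono by blast
  then show ?thesis using disj fK inj by (simp add: card_Un_disjoint card_image)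
qed

text \<open>As long as \<open>H\<close> is nontrivial, some \<open>F b\<close> misses an element of
  it. Replacing \<open>H\<close> by \<open>H \<inter> F b\<close> at least halves its order, so the
  number of chosen \<open>b\<close> is at most the binary logarithm of the order of
  \<open>H\<close>.\<close>

lemma (in group) greedy_trivial_intersection:
  assumes "subgroup H G" "finite H"
    and "\<And>b. b \<in> B \<Longrightarrow> subgroup (F b) G"
    and "H \<inter> (\<Inter>b\<in>B. F b) \<subseteq> {\<one>}"
  shows "\<exists>D\<subseteq>B. finite D \<and> H \<inter> (\<Inter>b\<in>D. F b) \<subseteq> {\<one>} \<and> 2 ^ card D \<le> card H"
  using assms
proof (induction "card H" arbitrary: H rule: less_induct)
  case less
  show ?case
  proof (cases "H \<subseteq> {\<one>}")
    case True
    have "H \<noteq> {}" using less.prems(1) subgroup.one_closed by blast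
    then have "card H \<ge> 1" using less.prems(2) by (simp add: Suc_leI card_gt_0_iff)
    then show ?thesis using True by (intro exI[of _ "{}"]) auto
  next
    case False
    then obtain h where h: "h \<in> H" "h \<noteq> \<one>" by blast
    then obtain b where b: "b \<in> B" "h \<notin> F b" using less.prems(4) by blast
    let ?K = "H \<inter> F b"
    have K: "subgroup ?K G" using less.prems b by (simp add: subgroups_Inter_pair)
    have psub: "?K \<subset> H" using h b by blast
    have "card ?K < card H" using psub less.prems(2) psubset_card_mono by blast
    moreover have "?K \<inter> (\<Inter>b\<in>B. F b) \<subseteq> {\<one>}" using less.prems(4) by blast
    ultimately obtain D where D: "D \<subseteq> B" "finite D" "?K \<inter> (\<Inter>b\<in>D. F b) \<subseteq> {\<one>}"
        "2 ^ card D \<le> card ?K"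
      using less.hyps[of ?K] K less.prems(2,3) by blast
    have "2 ^ card (insert b D) \<le> (2::nat) ^ Suc (card D)"
      using D(2) by (intro power_increasing) (auto simp: card_insert_if)
    also have "\<dots> \<le> 2 * card ?K" using D(4) by simp
    also have "\<dots> \<le> card H"
      by (rule card_psubgroup_le[OF less.prems(1,2) K psub])
    finally have "2 ^ card (insert b D) \<le> card H" .
    then show ?thesis using D b by (intro exI[of _ "insert b D"]) auto
  qed
qed

section \<open>Group actions with a finite base and finite suborbits\<close>

locale based_action = group_action +
  fixes B
  assumes finite_base: "finite B"
    and base_nonempty: "B \<noteq> {}"
    and base_subset: "B \<subseteq> E"
    and base: "\<lbrakk>g \<in> carrier G; \<And>b. b \<in> B \<Longrightarrow> \<phi> g b = b\<rbrakk> \<Longrightarrow> g = \<one>"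
    and finite_suborbit:
      "\<lbrakk>x \<in> E; y \<in> E\<rbrakk> \<Longrightarrow> finite (orbit (G\<lparr>carrier := stabilizer G \<phi> x\<rparr>) \<phi> y)"
begin

sublocale group G
  using group_hom group_hom.axioms(1) by auto

lemma action_closed: "\<lbrakk>g \<in> carrier G; x \<in> E\<rbrakk> \<Longrightarrow> \<phi> g x \<in> E"
  using element_image by blast

lemma action_one: "x \<in> E \<Longrightarrow> \<phi> \<one> x = x"
  using id_eq_one by (metis restrict_apply')

lemma action_inv: "\<lbrakk>g \<in> carrier G; x \<in> E\<rbrakk> \<Longrightarrow> \<phi> (inv g) (\<phi> g x) = x"
  using orbit_sym_aux by blast

lemma eq_if_eq_on_base:
  assumes "g \<in> carrier G" "h \<in> carrier G" "\<And>b. b \<in> B \<Longrightarrow> \<phi> g b = \<phi> h b"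
  shows "g = h"
proof -
  have "inv h \<otimes> g = \<one>"
  proof (rule base)
    fix b assume b: "b \<in> B"
    have bE: "b \<in> E" using b base_subset by blast
    show "\<phi> (inv h \<otimes> g) b = b"
      using assms b bE by (simp add: composition_rule action_inv)
  qed (use assms in simp)
  then have "h \<otimes> (inv h \<otimes> g) = h" using assms by simp
  then show ?thesis using assms by (simp add: m_assoc[symmetric])
qed

text \<open>An element is determined by its values on \<open>B\<close>; for an element fixing
  \<open>x\<close>, each of these finitely many values lies in a finite suborbit.\<close>

lemma finite_stabilizer:
  assumes x: "x \<in> E"
  shows "finite (stabilizer G \<phi> x)"
proof -
  let ?O = "\<lambda>y. orbit (G\<lparr>carrier := stabilizer G \<phi> x\<rparr>) \<phi> y"
  have "inj_on (\<lambda>g. \<lambda>b\<in>B. \<phi> g b) (stabilizer G \<phi> x)"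
  proof (rule inj_onI)
    fix g h assume gh: "g \<in> stabilizer G \<phi> x" "h \<in> stabilizer G \<phi> x"
      and eq: "(\<lambda>b\<in>B. \<phi> g b) = (\<lambda>b\<in>B. \<phi> h b)"
    have "\<phi> g b = \<phi> h b" if "b \<in> B" for b
      using fun_cong[OF eq, of b] that by simp
    then show "g = h"
      using gh stabilizer_subset by (intro eq_if_eq_on_base) blast+
  qed
  moreover have "(\<lambda>g. \<lambda>b\<in>B. \<phi> g b) ` stabilizer G \<phi> x \<subseteq> PiE B ?O"
    by (auto simp: orbit_def)
  moreover have "finite (PiE B ?O)"
    using finite_base base_subset x by (intro finite_PiE finite_suborbit) auto
  ultimately show ?thesis using finite_subset finite_imageD by metis
qed

text \<open>This set is empty or lies in a coset of the finite stabilizer of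
  \<open>x\<close>.\<close>

lemma finite_transporter:
  assumes x: "x \<in> E"
  shows "finite {g \<in> carrier G. \<phi> g x = y}"
proof (cases "\<exists>g0\<in>carrier G. \<phi> g0 x = y")
  case True
  then obtain g0 where g0: "g0 \<in> carrier G" "\<phi> g0 x = y" by blast
  have "g \<in> (\<otimes>) g0 ` stabilizer G \<phi> x" if g: "g \<in> carrier G" "\<phi> g x = y" for g
  proof (rule image_eqI)
    show "g = g0 \<otimes> (inv g0 \<otimes> g)" using g g0 by (simp add: m_assoc[symmetric])
    have "\<phi> (inv g0) y = x" using g0 x action_inv by blast
    then show "inv g0 \<otimes> g \<in> stabilizer G \<phi> x"
      using g g0 x by (simp add: stabilizer_def composition_rule)
  qed
  then have "{g \<in> carrier G. \<phi> g x = y} \<subseteq> (\<otimes>) g0 ` stabilizer G \<phi> x" by blast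
  then show ?thesis using finite_stabilizer[OF x] finite_subset by blast
next
  case False
  then have "{g \<in> carrier G. \<phi> g x = y} = {}" by blast
  then show ?thesis by (simp only: finite.emptyI)
qed

lemma finite_transporter_sets:
  assumes "finite X" "X \<subseteq> E" "finite Y"
  shows "finite {g \<in> carrier G. \<exists>x\<in>X. \<phi> g x \<in> Y}"
proof -
  have "{g \<in> carrier G. \<exists>x\<in>X. \<phi> g x \<in> Y} = (\<Union>x\<in>X. \<Union>y\<in>Y. {g \<in> carrier G. \<phi> g x = y})"
    by blast
  then show ?thesis using assms finite_transporter by auto
qed

text \<open>The point \<open>c = \<phi> g x\<close> is chosen outside \<open>S\<close> and outside
  the images of \<open>S\<close> under the finitely many elements that send some point of
  \<open>S\<close> into \<open>S\<close>. If \<open>f\<close> preserves \<open>insert c S\<close>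
  but moves \<open>c\<close>, then \<open>f\<close> sends some \<open>s\<close> in \<open>S\<close>
  to \<open>c\<close> and another point of \<open>S\<close> into \<open>S\<close>, so
  \<open>c\<close> lies in one of the avoided images. Hence \<open>f\<close> fixes \<open>c\<close>
  and permutes the rest.\<close>

lemma exists_far_point:
  assumes S: "finite S" "S \<subseteq> E" "2 \<le> card S"
    and A: "A \<subseteq> carrier G" "infinite A" and x: "x \<in> E"
  shows "\<exists>g\<in>A. \<phi> g x \<notin> S \<and>
    (\<forall>f\<in>carrier G. \<phi> f ` insert (\<phi> g x) S = insert (\<phi> g x) S \<longrightarrow>
       \<phi> f (\<phi> g x) = \<phi> g x \<and> \<phi> f ` S = S)"
proof -
  let ?K = "{f \<in> carrier G. \<exists>s\<in>S. \<phi> f s \<in> S}"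
  let ?N = "\<Union>f\<in>?K. \<phi> f ` S"
  have "finite ?N" using finite_transporter_sets[OF S(1,2,1)] S(1) by blast
  then have "finite {g \<in> carrier G. \<exists>z\<in>{x}. \<phi> g z \<in> S \<union> ?N}"
    using x S(1) by (intro finite_transporter_sets) auto
  then obtain g where g: "g \<in> A" "\<phi> g x \<notin> S \<union> ?N"
    using A by (smt (verit) finite_subset insertI1 mem_Collect_eq subset_iff)
  let ?c = "\<phi> g x"
  have cE: "?c \<in> E" using g A x action_closed by blast
  have stab: "\<phi> f ?c = ?c \<and> \<phi> f ` S = S"
    if f: "f \<in> carrier G" and fx: "\<phi> f ` insert ?c S = insert ?c S" for f
  proof -
    have inj: "inj_on (\<phi> f) (insert ?c S)"
      using inj_prop[OF f] S cE by (meson inj_on_subset insert_subset)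
    have c: "\<phi> f ?c = ?c"
    proof (rule ccontr)
      assume "\<phi> f ?c \<noteq> ?c"
      moreover have "?c \<in> \<phi> f ` insert ?c S" unfolding fx by simp
      ultimately obtain s where s: "s \<in> S" "\<phi> f s = ?c" by auto
      \<comment> \<open>With a single point in \<open>S\<close>, \<open>f\<close> could swap it with
        \<open>c\<close>; a second point \<open>t\<close> rules this out.\<close>
      have "\<not> S \<subseteq> {s}"
        using S(3) card_mono[of "{s}" S] by auto
      then obtain t where t: "t \<in> S" "t \<noteq> s" by blast
      have "\<phi> f t \<noteq> ?c" using inj s t by (metis inj_onD insertCI)
      moreover have "\<phi> f t \<in> insert ?c S" using fx t by blast
      ultimately have "f \<in> ?K" using f t by blast
      then have "?c \<in> ?N" using s by (metis (no_types, lifting) UN_iff imageI)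
      then show False using g by blast
    qed
    have "\<phi> f ` S = \<phi> f ` (insert ?c S - {?c})" using g by simp
    also have "\<dots> = \<phi> f ` insert ?c S - \<phi> f ` {?c}"
      by (rule inj_on_image_set_diff[OF inj]) auto
    also have "\<dots> = S" using fx c g by simp
    finally show ?thesis using c by blast
  qed
  show ?thesis
  proof (intro bexI[OF _ g(1)] conjI)
    show "?c \<notin> S" using g by blast
  qed (intro ballI impI stab)
qed

definition setwise_base_stabilizer where
  "setwise_base_stabilizer = {h \<in> carrier G. \<phi> h ` B = B}"

lemma subgroup_setwise_base_stabilizer: "subgroup setwise_base_stabilizer G"
proof (rule subgroupI)
  show "setwise_base_stabilizer \<subseteq> carrier G"
    by (auto simp: setwise_base_stabilizer_def)
  have "\<phi> \<one> ` B = B"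
    using action_one base_subset by (force simp: image_iff)
  then show "setwise_base_stabilizer \<noteq> {}"
    by (auto simp: setwise_base_stabilizer_def)
next
  fix a assume "a \<in> setwise_base_stabilizer"
  then have a: "a \<in> carrier G" "\<phi> a ` B = B" by (auto simp: setwise_base_stabilizer_def)
  have "\<phi> (inv a) ` B = \<phi> (inv a) ` \<phi> a ` B" by (simp add: a)
  also have "\<dots> = id ` B"
    unfolding image_image using a base_subset by (intro image_cong) (auto simp: action_inv)
  also have "\<dots> = B" by simp
  finally show "inv a \<in> setwise_base_stabilizer"
    using a by (simp add: setwise_base_stabilizer_def)
next
  fix a b assume "a \<in> setwise_base_stabilizer" "b \<in> setwise_base_stabilizer"
  then have a: "a \<in> carrier G" "\<phi> a ` B = B" and b: "b \<in> carrier G" "\<phi> b ` B = B"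
    by (auto simp: setwise_base_stabilizer_def)
  have "\<phi> (a \<otimes> b) ` B = \<phi> a ` \<phi> b ` B"
    unfolding image_image using a b base_subset
    by (intro image_cong refl composition_rule) auto
  then show "a \<otimes> b \<in> setwise_base_stabilizer"
    using a b by (simp add: setwise_base_stabilizer_def)
qed

text \<open>Since \<open>B\<close> is a base, restriction to \<open>B\<close> embeds this stabilizer
  into the permutations of \<open>B\<close>. The map \<open>?r\<close> is the identity off
  \<open>B\<close>, as \<open>permutes\<close> demands.\<close>

lemma finite_setwise_base_stabilizer: "finite setwise_base_stabilizer"
  and card_setwise_base_stabilizer: "card setwise_base_stabilizer \<le> fact (card B)"
proof -
  let ?r = "\<lambda>h x. if x \<in> B then \<phi> h x else x"
  have inj: "inj_on ?r setwise_base_stabilizer"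
  proof (rule inj_onI)
    fix g h assume gh: "g \<in> setwise_base_stabilizer" "h \<in> setwise_base_stabilizer"
      and eq: "?r g = ?r h"
    have "\<phi> g b = \<phi> h b" if "b \<in> B" for b
      using fun_cong[OF eq, of b] that by simp
    then show "g = h"
      using gh by (intro eq_if_eq_on_base) (auto simp: setwise_base_stabilizer_def)
  qed
  have sub: "?r ` setwise_base_stabilizer \<subseteq> {p. p permutes B}"
  proof safe
    fix h assume "h \<in> setwise_base_stabilizer"
    then have h: "h \<in> carrier G" "\<phi> h ` B = B" by (auto simp: setwise_base_stabilizer_def)
    have "inj_on (\<phi> h) B" using inj_prop[OF h(1)] base_subset inj_on_subset by blast
    then have "bij_betw (\<phi> h) B B" using h by (simp add: bij_betw_def)
    then have "bij_betw (?r h) B B" by (simp cong: bij_betw_cong)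
    then show "?r h permutes B" by (rule bij_imp_permutes) simp
  qed
  have fin: "finite {p. p permutes B}" using finite_base finite_permutations by blast
  show "finite setwise_base_stabilizer"
    using finite_imageD[OF finite_subset[OF sub fin] inj] .
  show "card setwise_base_stabilizer \<le> fact (card B)"
    using card_inj_on_le[OF inj sub fin] card_permutations[OF refl finite_base] by simp
qed

text \<open>For each \<open>d\<close> in \<open>D\<close> a far point \<open>\<phi> g d\<close> is
  added, with \<open>g\<close> in \<open>A\<close> depending on \<open>d\<close>. The hypothesis
  \<open>type\<close> makes the constraint \<open>F d\<close> on elements fixing that point
  independent of the choice of \<open>g\<close>.\<close>

lemma extend_base:
  assumes "finite D" "D \<subseteq> B" "2 \<le> card B \<or> D = {}"
    and A: "A \<subseteq> carrier G" "infinite A"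
    and type: "\<And>g h b. \<lbrakk>g \<in> A; h \<in> setwise_base_stabilizer; b \<in> B\<rbrakk>
      \<Longrightarrow> \<phi> h (\<phi> g b) = \<phi> g b \<Longrightarrow> h \<in> F b"
  shows "\<exists>S. finite S \<and> B \<subseteq> S \<and> S \<subseteq> E \<and> card S = card B + card D \<and>
    (\<forall>f\<in>carrier G. \<phi> f ` S = S \<longrightarrow> f \<in> setwise_base_stabilizer \<inter> (\<Inter>b\<in>D. F b))"
  using assms(1-3)
proof (induction D rule: finite_induct)
  case empty
  show ?case
    using finite_base base_subset by (intro exI[of _ B]) (auto simp: setwise_base_stabilizer_def)
next
  case (insert d D)
  then obtain S where S: "finite S" "B \<subseteq> S" "S \<subseteq> E" "card S = card B + card D"
    and stab: "\<And>f. \<lbrakk>f \<in> carrier G; \<phi> f ` S = S\<rbrakk>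
      \<Longrightarrow> f \<in> setwise_base_stabilizer \<inter> (\<Inter>b\<in>D. F b)"
    by auto
  have d: "d \<in> B" "d \<in> E" using insert.prems base_subset by auto
  have "2 \<le> card S" using S(4) insert.prems by auto
  then obtain g where g: "g \<in> A" "\<phi> g d \<notin> S"
    and far: "\<And>f. \<lbrakk>f \<in> carrier G; \<phi> f ` insert (\<phi> g d) S = insert (\<phi> g d) S\<rbrakk>
       \<Longrightarrow> \<phi> f (\<phi> g d) = \<phi> g d \<and> \<phi> f ` S = S"
    using exists_far_point[OF S(1,3) _ A d(2)] by blast
  have "f \<in> setwise_base_stabilizer \<inter> (\<Inter>b\<in>insert d D. F b)"
    if f: "f \<in> carrier G" "\<phi> f ` insert (\<phi> g d) S = insert (\<phi> g d) S" for f
    using far[OF f] stab[OF f(1)] type[OF g(1) _ d(1), of f] by auto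
  moreover have "\<phi> g d \<in> E" using g A d action_closed by blast
  ultimately show ?case
    using S g insert.hyps by (intro exI[of _ "insert (\<phi> g d) S"]) auto
qed

text \<open>Both bounds on \<open>d\<close> are recorded: \<open>d \<le> card B\<close> serves for
  large bases, the bound by the factorial improves it for bases of at most three points.\<close>

theorem exists_distinguishing:
  assumes inf: "infinite (carrier G)"
  shows "\<exists>S d. finite S \<and> S \<subseteq> E \<and> (\<forall>f\<in>carrier G. \<phi> f ` S = S \<longrightarrow> f = \<one>) \<and>
    card S = card B + d \<and> d \<le> card B \<and> 2 ^ d \<le> (fact (card B) :: nat)"
proof -
  let ?H = setwise_base_stabilizer
  \<comment> \<open>The type of \<open>g\<close>. There are finitely many types, so infinitely many
    \<open>g\<close> share one.\<close>
  let ?T = "\<lambda>g. {(h, b) \<in> ?H \<times> B. \<phi> h (\<phi> g b) = \<phi> g b}"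
  have fin: "finite ?H" by (rule finite_setwise_base_stabilizer)
  have "?T ` carrier G \<subseteq> Pow (?H \<times> B)" by blast
  then have "finite (?T ` carrier G)"
    using fin finite_base by (meson finite_Pow_iff finite_SigmaI finite_subset)
  then obtain g0 where g0: "g0 \<in> carrier G" and "infinite {g \<in> carrier G. ?T g = ?T g0}"
    using pigeonhole_infinite[OF inf, of ?T] by blast
  moreover define A where "A = {g \<in> carrier G. ?T g = ?T g0}"
  ultimately have A: "A \<subseteq> carrier G" "infinite A" by auto
  define F where "F b = stabilizer G \<phi> (\<phi> g0 b)" for b
  have type: "h \<in> F b"
    if "g \<in> A" "h \<in> ?H" "b \<in> B" "\<phi> h (\<phi> g b) = \<phi> g b" for g h b
  proof -
    have "(h, b) \<in> ?T g" using that by simp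
    also have "?T g = ?T g0" using that A_def by simp
    finally show ?thesis by (simp add: F_def stabilizer_def setwise_base_stabilizer_def)
  qed
  have "subgroup (F b) G" if "b \<in> B" for b
    unfolding F_def using that g0 base_subset by (intro stabilizer_subgroup action_closed) auto
  \<comment> \<open>An element fixing \<open>g0 b\<close> for all \<open>b \<in> B\<close> is trivial since \<open>g0 B\<close> is a base too.\<close>
  moreover have "?H \<inter> (\<Inter>b\<in>B. F b) \<subseteq> {\<one>}"
  proof
    fix h assume h: "h \<in> ?H \<inter> (\<Inter>b\<in>B. F b)"
    then have hG: "h \<in> carrier G" by (simp add: setwise_base_stabilizer_def)
    have "h \<otimes> g0 = g0"
    proof (rule eq_if_eq_on_base)
      fix b assume b: "b \<in> B"
      then show "\<phi> (h \<otimes> g0) b = \<phi> g0 b"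
        using h hG g0 base_subset by (auto simp: composition_rule F_def stabilizer_def)
    qed (use hG g0 in auto)
    then show "h \<in> {\<one>}" using hG g0 r_cancel_one by simp
  qed
  ultimately obtain D where D: "D \<subseteq> B" "finite D" "?H \<inter> (\<Inter>b\<in>D. F b) \<subseteq> {\<one>}"
      "2 ^ card D \<le> card ?H"
    using greedy_trivial_intersection[OF subgroup_setwise_base_stabilizer fin, of B F] by blast
  have pow: "2 ^ card D \<le> (fact (card B) :: nat)"
    using D(4) card_setwise_base_stabilizer by linarith
  \<comment> \<open>Far points need a set with two elements. For a smaller base the factorial is 1,
    which forces \<open>D\<close> to be empty.\<close>
  have big: "2 \<le> card B \<or> D = {}"
  proof (rule ccontr)
    assume *: "\<not> (2 \<le> card B \<or> D = {})"
    then have "card D \<ge> 1" using D(2) by (simp add: Suc_leI card_gt_0_iff)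
    then have "2 ^ 1 \<le> (2::nat) ^ card D" by (intro power_increasing) auto
    moreover have "fact (card B) = (1::nat)"
      using * by (cases "card B = 0") (auto simp: not_le less_Suc_eq numeral_2_eq_2)
    ultimately show False using pow by simp
  qed
  have "\<exists>S. finite S \<and> B \<subseteq> S \<and> S \<subseteq> E \<and> card S = card B + card D \<and>
    (\<forall>f\<in>carrier G. \<phi> f ` S = S \<longrightarrow> f \<in> ?H \<inter> (\<Inter>b\<in>D. F b))"
    by (rule extend_base[OF D(2,1) big A]) (rule type)
  then obtain S where S: "finite S" "S \<subseteq> E" "card S = card B + card D"
    and stab: "\<forall>f\<in>carrier G. \<phi> f ` S = S \<longrightarrow> f \<in> ?H \<inter> (\<Inter>b\<in>D. F b)"
    by blast
  have "f = \<one>" if "f \<in> carrier G" "\<phi> f ` S = S" for f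
    using stab that D(3) by (meson singletonD subsetD)
  moreover have "card D \<le> card B" using D(1) finite_base card_mono by blast
  ultimately show ?thesis
    using S pow by (intro exI[of _ S] exI[of _ "card D"]) simp
qed

end

section \<open>Binary digits and the numerical bound\<close>

lemma finite_bits_nat: "finite {k. bit (n::nat) k}"
proof (rule finite_subset)
  show "{k. bit n k} \<subseteq> {..<n}"
  proof
    fix k assume "k \<in> {k. bit n k}"
    then have "odd (n div 2 ^ k)" by (simp add: bit_iff_odd)
    then have "n div 2 ^ k \<noteq> 0" by (intro notI) simp
    then have "2 ^ k \<le> n" by (simp add: div_eq_0_iff)
    moreover have "k < 2 ^ k" by (rule less_exp)
    ultimately have "k < n" by (rule order.strict_trans2[rotated])
    then show "k \<in> {..<n}" by simp
  qed
qed simp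

lemma binary_ones_rec: "binary_ones n = n mod 2 + binary_ones (n div 2)"
proof -
  have "{k. bit n k} = (if odd n then {0} else {}) \<union> Suc ` {k. bit (n div 2) k}"
    (is "?L = ?R")
  proof (rule Set.set_eqI)
    fix k show "k \<in> ?L \<longleftrightarrow> k \<in> ?R"
      by (cases k) (auto simp: bit_0 bit_Suc)
  qed
  moreover have "card (Suc ` {k. bit (n div 2) k}) = binary_ones (n div 2)"
    unfolding binary_ones_def by (rule card_image) simp
  moreover have "finite (Suc ` {k. bit (n div 2) k})" using finite_bits_nat by blast
  ultimately show ?thesis
    by (cases "even n") (simp_all add: binary_ones_def card_insert_disjoint odd_iff_mod_2_eq_one[THEN iffD1] image_iff)
qed

lemma binary_ones_0 [simp]: "binary_ones 0 = 0"
  by (simp add: binary_ones_def)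

lemma binary_ones_le: "binary_ones n \<le> n"
proof (induction n rule: less_induct)
  case (less n)
  show ?case
  proof (cases "n = 0")
    case False
    then have "binary_ones (n div 2) \<le> n div 2" using less by simp
    then show ?thesis using binary_ones_rec[of n] by presburger
  qed simp
qed

lemma binary_ones_less:
  assumes "2 \<le> n"
  shows "binary_ones n < n"
  using binary_ones_rec[of n] binary_ones_le[of "n div 2"] assms by presburger

text \<open>Writing the ceiling as \<open>3 n - n div 2\<close> and splitting off the last binary
  digit of \<open>n\<close> leaves an inequality in \<open>d\<close> and \<open>n div 2\<close>. For
  \<open>n \<ge> 4\<close>, \<open>n div 2\<close> is at least 2 and so exceeds its digit sum, which
  supplies the missing 1.\<close>

lemma cost_bound:
  assumes n: "0 < n" and d: "d \<le> n" "2 ^ d \<le> (fact n :: nat)"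
  shows "int (n + d) \<le> \<lceil>5 * real n / 2\<rceil> - int (binary_ones n) - 1"
proof -
  have "\<lceil>5 * real n / 2\<rceil> = 3 * int n - int (n div 2)"
    by (rule ceiling_unique; cases "even n")
       (auto simp: field_simps elim!: evenE oddE)
  moreover have "d + binary_ones (n div 2) + n mod 2 + n div 2 + 1 \<le> 2 * n"
  proof (cases "n \<ge> 4")
    case True
    then have "binary_ones (n div 2) < n div 2" by (intro binary_ones_less) simp
    then show ?thesis using d(1) by presburger
  next
    case False
    \<comment> \<open>For \<open>n\<close> = 1, 2, 3 the power \<open>2 ^ n\<close> exceeds
      \<open>fact n\<close>, and the missing 1 comes from \<open>d\<close> instead.\<close>
    have "d < n"
    proof (rule ccontr)
      assume "\<not> d < n"
      then have "d = n" using d by simp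
      moreover have "n = 1 \<or> n = 2 \<or> n = 3" using n False by auto
      ultimately show False using d(2) by (auto simp: fact_numeral)
    qed
    then show ?thesis using binary_ones_le[of "n div 2"] by presburger
  qed
  ultimately show ?thesis using binary_ones_rec[of n] by linarith
qed

section \<open>The automorphism group of a graph\<close>

theorem theorem3:
  fixes G :: "'a pair_pre_digraph" and B :: "'a set" and n :: nat
  assumes "pair_bidirected_digraph G"
    and "infinite (carrier (Aut G))"
    and "subdegree_finite (Aut G) (pverts G)"
    and "finite B" and "is_base G B" and "n = card B"
  shows "\<exists>S. finite S \<and> distinguishing G S \<and>
           int (card S) \<le> \<lceil>5 * real n / 2\<rceil> - int (binary_ones n) - 1"
proof -
  have base: "pointwise_stabilizer (Aut G) B = {\<one>\<^bsub>Aut G\<^esub>}" "B \<subseteq> pverts G"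
    using assms(5) by (auto simp: is_base_def)
  have hom: "group_hom (Aut G) (BijGroup (pverts G)) (\<lambda>f. f)"
  proof -
    have "(\<lambda>f. f) \<in> hom (Aut G) (BijGroup (pverts G))"
      by (auto simp: hom_def Aut_def BijGroup_def)
    then show ?thesis
      using group_Aut[of G] group_BijGroup[of "pverts G"] by (simp add: group_hom_def group_hom_axioms_def)
  qed
  interpret based_action "Aut G" "pverts G" "\<lambda>f. f" B
  proof (intro based_action.intro group_action.intro based_action_axioms.intro)
    show "group_hom (Aut G) (BijGroup (pverts G)) (\<lambda>f. f)" by (rule hom)
    show "finite B" "B \<subseteq> pverts G" using assms(4) base by auto
    \<comment> \<open>An empty base would make \<open>Aut G\<close> trivial, but it is
      infinite.\<close>
    show "B \<noteq> {}"
    proof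
      assume "B = {}"
      then have "carrier (Aut G) = {\<one>\<^bsub>Aut G\<^esub>}"
        using base(1) by (simp add: pointwise_stabilizer_def)
      then show False using assms(2) by simp
    qed
    show "g = \<one>\<^bsub>Aut G\<^esub>" if "g \<in> carrier (Aut G)" "\<And>b. b \<in> B \<Longrightarrow> g b = b" for g
      using that base(1) unfolding pointwise_stabilizer_def by blast
    show "finite (orbit (Aut G\<lparr>carrier := stabilizer (Aut G) (\<lambda>f. f) x\<rparr>) (\<lambda>f. f) y)"
      if "x \<in> pverts G" "y \<in> pverts G" for x y
      using assms(3) that unfolding subdegree_finite_def orbits_def by blast
  qed
  obtain S d where S: "finite S" "S \<subseteq> pverts G"
      "\<forall>f\<in>carrier (Aut G). f ` S = S \<longrightarrow> f = \<one>\<^bsub>Aut G\<^esub>" "card S = n + d"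
    and d: "d \<le> n" "2 ^ d \<le> (fact n :: nat)"
    using exists_distinguishing[OF assms(2)] assms(6) by blast
  have "0 < n" using assms(4,6) base_nonempty by (simp add: card_gt_0_iff)
  then show ?thesis
    using S cost_bound[OF _ d] by (auto simp: distinguishing_def intro!: exI[of _ S])
qed

end
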